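(* Let $k\ge 2$, let $G'$ be either $\overrightarrow{\mathcal{G}}_{k}$ or $\overleftarrow{\mathcal{G}}_{k}$ with vertices $v_1,\dots,v_{2^k-1}$, and let $\Gamma'$ be the union of $G'$ and directed graphs $N_t$, $t\in I$ ($I$ an index set), such that for each $t\in I$ the graphs $G'$ and $N_t$ intersect exactly in one vertex $v_i$, for some $i=i(t)\in\{2,\dots,2^k-2\}$, and $v_i$ is the only vertex of attachment of $N_t$ in $\Gamma'$. Suppose that for each $t\in I$, with $i=i(t)$, $\chi_r(N_t)=h(i)$. If for each $t\in I$ there is a ranking function $f_t$ of $N_t$ (with labels in $\{1,\dots,\chi_r(N_t)\}$) such that $f_t(v_i)=h(i)$, then $\chi_r(\Gamma')=\chi_r(\overrightarrow{P}_{2^{k}-1})$.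
   Context: All directed graphs are finite, with no loops and at most one edge in each direction between two vertices. A $k$-ranking of a directed graph $G$ is a labeling $f:V(G)\to\{1,\dots,k\}$ such that whenever $u\ne v$ and $f(u)=f(v)$, every directed path connecting $u$ and $v$ (in either direction) contains a vertex $w$ with $f(w)>f(u)$; such an $f$ is a ranking function. The rank number $\chi_r(G)$ is the smallest $k$ such that $G$ has a $k$-ranking. $\overrightarrow{P}_{\eta}$ is the directed path with vertices $v_1,\dots,v_\eta$ and edges $v_i\to v_{i+1}$, $1\le i<\eta$. Direct sum graphs of type I: $\overrightarrow{\mathcal{G}}_2=\overrightarrow{P}_3$. Given $\overrightarrow{\mathcal{G}}_i$ with vertices $v_1,\dots,v_{2^i-1}$, take a copy $\overrightarrow{\mathcal{G}}_i'$ with vertices $w_1,\dots,w_{2^i-1}$ ($w_t$ corresponding to $v_t$). $\overrightarrow{\mathcal{G}}_{i+1}$ has all these vertices and a new vertex $v_{2^i}$; its edges are all edges of $\overrightarrow{\mathcal{G}}_i$ and $\overrightarrow{\mathcal{G}}_i'$, the edges $v_j\to v_{2^i}$ and $v_{2^i}\to w_j$ for $1\le j\le 2^i-1$, and the edges $v_k\to w_j$ for every edge $v_k\to v_j$ of $\overrightarrow{\mathcal{G}}_i$; then $w_t$ is renamed $v_{2^i+t}$. Direct sum graphs of type II: $\overleftarrow{\mathcal{G}}_2$ is $\overrightarrow{P}_3$ together with $v_2\to v_1$ and $v_3\to v_2$. $\overleftarrow{\mathcal{G}}_{i+1}$ is obtained in the same manner from $\overleftarrow{\mathcal{G}}_i$,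 its copy on $w_1,\dots,w_{2^i-1}$ and a new vertex $v_{2^i}$, by adding $v_{2^i-1}\to v_{2^i}$, $v_{2^i}\to w_1$, and $v_{2^i}\to v_j$, $w_j\to v_{2^i}$ for $1\le j\le 2^i-1$; then $w_t$ is renamed $v_{2^i+t}$. $h(i)$ denotes the label of $v_i$ in the standard minimal ranking $f$ of $\overrightarrow{P}_{2^k-1}$: $h(i)=f(v_i)=\alpha+1$ where $2^\alpha$ is the highest power of $2$ dividing $i$. A vertex of attachment of a subgraph $W_1$ in a graph $W_2$ is a vertex of $W_1$ that is incident with some edge of $W_2$ that is not an edge of $W_1$. *)

theory Defs
  imports "Graph_Theory.Graph_Theory" "HOL-Computational_Algebra.Primes" "HOL-Library.FuncSet"
begin

text \<open>
  A directed graph is a \<^typ>\<open>'a pair_pre_digraph\<close> satisfying \<^locale>\<open>pair_digraph\<close>: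
  finite, loop-free, and with arcs that are pairs of vertices, so that there is at most one arc
  in each direction between two vertices.
\<close>

section \<open>Rankings\<close>

text \<open>
  The condition ranges over all ordered pairs \<open>(u, v)\<close>, hence covers the directed paths connecting
  two vertices in either direction.
\<close>

definition k_ranking :: "'a pair_pre_digraph \<Rightarrow> nat \<Rightarrow> ('a \<Rightarrow> nat) \<Rightarrow> bool" where
  "k_ranking G k f \<longleftrightarrow>
     f \<in> pverts G \<rightarrow> {1..k} \<and>
     (\<forall>u \<in> pverts G. \<forall>v \<in> pverts G. u \<noteq> v \<and> f u = f v \<longrightarrow>
        (\<forall>p. pre_digraph.apath (with_proj G) u p v \<longrightarrow>
           (\<exists>w \<in> set (pre_digraph.awalk_verts (with_proj G) u p). f w > f u)))"

definition rank_number :: "'a pair_pre_digraph \<Rightarrow> nat" where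
  "rank_number G = (LEAST k. \<exists>f. k_ranking G k f)"


section \<open>Operations on directed graphs\<close>

definition relabel :: "('a \<Rightarrow> 'b) \<Rightarrow> 'a pair_pre_digraph \<Rightarrow> 'b pair_pre_digraph" where
  "relabel g G = \<lparr> pverts = g ` pverts G, parcs = map_prod g g ` parcs G \<rparr>"

definition pair_Union :: "'a pair_pre_digraph set \<Rightarrow> 'a pair_pre_digraph" where
  "pair_Union S = \<lparr> pverts = (\<Union>G\<in>S. pverts G), parcs = (\<Union>G\<in>S. parcs G) \<rparr>"

lemma with_proj_pair_Union:
  "with_proj (pair_Union S) = pre_digraph.Union (with_proj G) (with_proj ` S)"
  by (simp add: pair_Union_def pre_digraph.Union_def with_proj_def)

definition attachment_verts :: "'a pair_pre_digraph \<Rightarrow> 'a pair_pre_digraph \<Rightarrow> 'a set" where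
  "attachment_verts W1 W2 =
     {x \<in> pverts W1. \<exists>e \<in> parcs W2 - parcs W1. x = fst e \<or> x = snd e}"


section \<open>Directed paths and direct sum graphs\<close>

text \<open>The vertex \<open>v\<^sub>i\<close> is represented by the number \<open>i\<close>.\<close>

definition dpath :: "nat \<Rightarrow> nat pair_pre_digraph" where
  "dpath \<eta> = \<lparr> pverts = {1..\<eta>}, parcs = {(i, i + 1) | i. 1 \<le> i \<and> i < \<eta>} \<rparr>"

text \<open>
  In the extension of the \<open>i\<close>-th graph, the vertex \<open>w\<^sub>t\<close> of the copy is directly given its final
  name \<open>2 ^ i + t\<close>.
\<close>

definition extend_I :: "nat \<Rightarrow> nat pair_pre_digraph \<Rightarrow> nat pair_pre_digraph" where
  "extend_I i G = (let c = 2 ^ i; G' = relabel (\<lambda>t. c + t) G in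
     \<lparr> pverts = pverts G \<union> {c} \<union> pverts G',
       parcs = parcs G \<union> parcs G'
         \<union> {(j, c) | j. 1 \<le> j \<and> j \<le> 2 ^ i - 1}
         \<union> {(c, c + j) | j. 1 \<le> j \<and> j \<le> 2 ^ i - 1}
         \<union> {(k, c + j) | k j. (k, j) \<in> parcs G} \<rparr>)"

definition extend_II :: "nat \<Rightarrow> nat pair_pre_digraph \<Rightarrow> nat pair_pre_digraph" where
  "extend_II i G = (let c = 2 ^ i; G' = relabel (\<lambda>t. c + t) G in
     \<lparr> pverts = pverts G \<union> {c} \<union> pverts G',
       parcs = parcs G \<union> parcs G'
         \<union> {(2 ^ i - 1, c), (c, c + 1)}
         \<union> {(c, j) | j. 1 \<le> j \<and> j \<le> 2 ^ i - 1}
         \<union> {(c + j, c) | j. 1 \<le> j \<and> j \<le> 2 ^ i - 1} \<rparr>)"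

text \<open>Both families start at index 2; the values at 0 and 1 are irrelevant.\<close>

fun direct_sum_I :: "nat \<Rightarrow> nat pair_pre_digraph" where
  "direct_sum_I i = (if i \<le> 2 then dpath 3 else extend_I (i - 1) (direct_sum_I (i - 1)))"

fun direct_sum_II :: "nat \<Rightarrow> nat pair_pre_digraph" where
  "direct_sum_II i =
     (if i \<le> 2 then \<lparr> pverts = pverts (dpath 3), parcs = parcs (dpath 3) \<union> {(2, 1), (3, 2)} \<rparr>
      else extend_II (i - 1) (direct_sum_II (i - 1)))"

declare direct_sum_I.simps [simp del] direct_sum_II.simps [simp del]

lemma direct_sum_I_2: "direct_sum_I 2 = dpath 3"
  by (simp add: direct_sum_I.simps)

lemma direct_sum_I_Suc: "i \<ge> 2 \<Longrightarrow> direct_sum_I (Suc i) = extend_I i (direct_sum_I i)"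
  by (subst direct_sum_I.simps) simp

lemma direct_sum_II_2:
  "direct_sum_II 2 = \<lparr> pverts = {1..3}, parcs = parcs (dpath 3) \<union> {(2, 1), (3, 2)} \<rparr>"
  by (simp add: direct_sum_II.simps dpath_def)

lemma direct_sum_II_Suc: "i \<ge> 2 \<Longrightarrow> direct_sum_II (Suc i) = extend_II i (direct_sum_II i)"
  by (subst direct_sum_II.simps) simp

lemma split_range:
  "{1..2 ^ i - 1} \<union> {2 ^ i} \<union> (\<lambda>t. 2 ^ i + t) ` {1..2 ^ i - 1} = {1..2 ^ Suc i - (1::nat)}"
proof -
  have "(\<lambda>t. 2 ^ i + t) ` {1..2 ^ i - 1} = {2 ^ i + (1::nat)..2 ^ i + (2 ^ i - 1)}"
    by simp
  moreover have "(2::nat) ^ i \<ge> 1" by simp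
  ultimately show ?thesis by auto
qed

lemma pverts_direct_sum_I: "i \<ge> 2 \<Longrightarrow> pverts (direct_sum_I i) = {1..2 ^ i - 1}"
proof (induction i rule: nat_induct_at_least)
  case base
  show ?case by (simp add: direct_sum_I_2 dpath_def)
next
  case (Suc n)
  then show ?case
    using split_range[of n] by (simp add: direct_sum_I_Suc extend_I_def relabel_def Let_def)
qed

lemma pverts_direct_sum_II: "i \<ge> 2 \<Longrightarrow> pverts (direct_sum_II i) = {1..2 ^ i - 1}"
proof (induction i rule: nat_induct_at_least)
  case base
  show ?case by (simp add: direct_sum_II_2)
next
  case (Suc n)
  then show ?case
    using split_range[of n] by (simp add: direct_sum_II_Suc extend_II_def relabel_def Let_def)
qed

text \<open>
  The label of \<open>v\<^sub>i\<close> in the standard minimal ranking of a directed path with \<open>2 ^ k - 1\<close> vertices: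
  one more than the exponent of the highest power of 2 dividing \<open>i\<close>, for \<open>i \<ge> 1\<close>.
\<close>

definition standard_label :: "nat \<Rightarrow> nat" where
  "standard_label i = multiplicity 2 i + 1"

end

theory Submission
  imports Defs
begin

text \<open>
  The standard labels on \<open>G'\<close> and the given rankings of the \<open>N t\<close> glue to a \<open>k\<close>-ranking of \<open>\<Gamma>'\<close>:
  within \<open>N t\<close> the attachment vertex carries the largest available label, and no other vertex
  carrying that label is joined to it, so every path leaving \<open>N t\<close> from a different vertex passes
  through a strictly larger label. That the standard labels rank \<open>G'\<close> is seen modulo \<open>2 ^ l\<close>: the
  vertices with label at most \<open>l\<close> are the non-multiples of \<open>2 ^ l\<close>, those with label \<open>l\<close> are all
  congruent to \<open>2 ^ (l - 1)\<close>, and an arc between non-multiples of \<open>2 ^ l\<close> strictly increases the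
  remainder (type I) or keeps the quotient (type II). For the lower bound, \<open>\<Gamma>'\<close> contains a directed
  path with \<open>2 ^ k - 1\<close> vertices, and a maximal label on a directed path can occur only once.
\<close>

section \<open>Rankings as a reachability condition\<close>

text \<open>Both ends are tested, so a nonempty chain of these arcs is a walk with no label above
  \<open>l\<close>. The closure \<open>(low_arcs G f l)\<^sup>*\<close> also contains every pair
  \<open>(x, x)\<close>.\<close>

definition low_arcs :: "'a pair_pre_digraph \<Rightarrow> ('a \<Rightarrow> nat) \<Rightarrow> nat \<Rightarrow> 'a rel" where
  "low_arcs G f l = {(x, y) \<in> parcs G. f x \<le> l \<and> f y \<le> l}"

lemma awalk_low_arcs_rtrancl:
  assumes "pre_digraph.awalk (with_proj G) u p v"
    and "\<forall>w \<in> set (pre_digraph.awalk_verts (with_proj G) u p). f w \<le> l"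
  shows "(u, v) \<in> (low_arcs G f l)\<^sup>*"
proof -
  have "set p \<subseteq> parcs G \<Longrightarrow> pcas u p v \<Longrightarrow> \<forall>w \<in> set (pawalk_verts u p). f w \<le> l \<Longrightarrow>
    (u, v) \<in> (low_arcs G f l)\<^sup>*"
  proof (induction p arbitrary: u)
    case (Cons e p)
    have "snd e \<in> set (pawalk_verts (snd e) p)"
      using Cons.prems(2) by (cases p) auto
    then have "(u, snd e) \<in> low_arcs G f l"
      using Cons.prems by (auto simp: low_arcs_def)
    moreover have "(snd e, v) \<in> (low_arcs G f l)\<^sup>*"
      using Cons by simp
    ultimately show ?case by (rule converse_rtrancl_into_rtrancl)
  qed simp
  then show ?thesis
    using assms by (simp add: pre_digraph.awalk_def cas_with_proj_eq awalk_verts_with_proj_eq)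
qed

lemma (in pair_wf_digraph) rtrancl_imp_awalk:
  assumes "(u, v) \<in> r\<^sup>*" "r \<subseteq> parcs G" "u \<in> pverts G"
  shows "\<exists>p. awalk u p v \<and> set p \<subseteq> r"
  using assms(1)
proof (induction rule: rtrancl_induct)
  case base
  then show ?case using assms(3) by (auto simp: awalk_Nil_iff intro: exI[of _ "[]"])
next
  case (step y z)
  then obtain p where p: "awalk u p y" "set p \<subseteq> r" by blast
  have "awalk y [(y, z)] z"
    using step(2) assms(2) by (auto simp: awalk_simps intro: wellformed')
  then have "awalk u (p @ [(y, z)]) z"
    using p(1) by (rule awalk_appendI[rotated])
  then show ?case using p(2) step(2) by (intro exI[of _ "p @ [(y, z)]"]) auto
qed

text \<open>A path violating the condition is one that stays at labels at most \<open>f u\<close>,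
  that is, a chain of low arcs. The quantifier over paths thus becomes an \<open>rtrancl\<close>
  statement, open to induction arc by arc.\<close>

lemma (in pair_wf_digraph) k_ranking_iff:
  "k_ranking G k f \<longleftrightarrow> f \<in> pverts G \<rightarrow> {1..k} \<and>
     (\<forall>u \<in> pverts G. \<forall>v \<in> pverts G.
        f u = f v \<and> (u, v) \<in> (low_arcs G f (f u))\<^sup>* \<longrightarrow> u = v)"
proof -
  have "(\<exists>p. apath u p v \<and> \<not> (\<exists>w \<in> set (pawalk_verts u p). f w > f u)) \<longleftrightarrow>
      (u, v) \<in> (low_arcs G f (f u))\<^sup>*" (is "?L \<longleftrightarrow> ?R") if u: "u \<in> pverts G" for u v
  proof
    assume ?L
    then show ?R
      using awalk_low_arcs_rtrancl[of G u _ v f "f u"]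
      by (auto simp: apath_def not_less)
  next
    assume ?R
    moreover have "low_arcs G f (f u) \<subseteq> parcs G" by (auto simp: low_arcs_def)
    ultimately obtain p where p: "awalk u p v" "set p \<subseteq> low_arcs G f (f u)"
      using rtrancl_imp_awalk[OF _ _ u] by blast
    \<comment> \<open>Cutting out cycles keeps only arcs of \<open>p\<close>, so the label bound
      survives.\<close>
    define q where "q = awalk_to_apath p"
    have q: "apath u q v" "set q \<subseteq> low_arcs G f (f u)"
      using apath_awalk_to_apath[OF p(1)] awalk_to_apath_subset[OF p(1)] p(2)
      by (auto simp: q_def)
    have "\<not> f w > f u" if "w \<in> set (pawalk_verts u q)" for w
    proof -
      \<comment> \<open>\<open>{u}\<close> covers the empty path, where
        \<open>w = u\<close>.\<close>
      have "w \<in> {u} \<union> set (map fst q) \<union> set (map snd q)"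
        using that set_awalk_verts[of u q v] q(1) by (simp add: apath_def)
      then show ?thesis using q(2) by (auto simp: low_arcs_def)
    qed
    then show ?L using q(1) by blast
  qed
  then have "(u \<noteq> v \<and> f u = f v \<longrightarrow>
        (\<forall>p. apath u p v \<longrightarrow> (\<exists>w \<in> set (pawalk_verts u p). f w > f u))) \<longleftrightarrow>
      (f u = f v \<and> (u, v) \<in> (low_arcs G f (f u))\<^sup>* \<longrightarrow> u = v)" if "u \<in> pverts G" for u v
    using that by blast
  then show ?thesis
    unfolding k_ranking_def awalk_verts_with_proj_eq by (intro conj_cong ball_cong refl)
qed

text \<open>\<open>g\<close> sends low arcs to low arcs, hence reachability to reachability, and
  injectivity brings equality back. This serves subgraphs and renamed copies alike.\<close>

lemma k_ranking_pullback:
  assumes "pair_wf_digraph G" "pair_wf_digraph H" "k_ranking G k f"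
    and "inj_on g (pverts H)" "g ` pverts H \<subseteq> pverts G" "map_prod g g ` parcs H \<subseteq> parcs G"
  shows "k_ranking H k (f \<circ> g)"
proof -
  interpret G: pair_wf_digraph G by fact
  interpret H: pair_wf_digraph H by fact
  have reach: "(g u, g v) \<in> (low_arcs G f l)\<^sup>*" if "(u, v) \<in> (low_arcs H (f \<circ> g) l)\<^sup>*" for u v l
    using that
  proof (induction rule: rtrancl_induct)
    case (step y z)
    then have "(g y, g z) \<in> low_arcs G f l"
      using assms(6) by (force simp: low_arcs_def)
    with step.IH show ?case by (rule rtrancl_into_rtrancl)
  qed simp
  show ?thesis
    unfolding H.k_ranking_iff
  proof (intro conjI ballI impI)
    show "f \<circ> g \<in> pverts H \<rightarrow> {1..k}"
      proof
      fix x assume "x \<in> pverts H"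
      then have "g x \<in> pverts G" using assms(5) by blast
      then show "(f \<circ> g) x \<in> {1..k}"
        using assms(3) unfolding k_ranking_def comp_apply by (blast dest: funcset_mem)
    qed
  next
    fix u v
    assume uv: "u \<in> pverts H" "v \<in> pverts H"
      and r: "(f \<circ> g) u = (f \<circ> g) v \<and> (u, v) \<in> (low_arcs H (f \<circ> g) ((f \<circ> g) u))\<^sup>*"
    then have "g u = g v"
      using reach assms(3,5) unfolding G.k_ranking_iff by (metis comp_apply image_subset_iff)
    then show "u = v" using assms(4) uv by (auto dest: inj_onD)
  qed
qed

lemma rank_number_eqI:
  assumes "k_ranking G k f" "\<And>k' f'. k_ranking G k' f' \<Longrightarrow> k \<le> k'"
  shows "rank_number G = k"
  unfolding rank_number_def using assms by (intro Least_equality) auto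

lemma pair_wf_digraph_relabel:
  assumes "pair_wf_digraph G"
  shows "pair_wf_digraph (relabel g G)"
  using pair_wf_digraph.arc_fst_in_verts[OF assms] pair_wf_digraph.arc_snd_in_verts[OF assms]
  by unfold_locales (force simp: relabel_def)+

text \<open>Pull back along the inverse of \<open>g\<close>, which maps the renamed graph into
  \<open>G\<close>.\<close>

lemma k_ranking_relabel:
  assumes "pair_wf_digraph G" "inj_on g (pverts G)" "k_ranking G k f"
  shows "k_ranking (relabel g G) k (f \<circ> the_inv_into (pverts G) g)"
proof (rule k_ranking_pullback[OF assms(1) pair_wf_digraph_relabel[OF assms(1)] assms(3)])
  let ?h = "the_inv_into (pverts G) g"
  show "inj_on ?h (pverts (relabel g G))" "?h ` pverts (relabel g G) \<subseteq> pverts G"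
    using assms(2) inj_on_the_inv_into by (auto simp: relabel_def the_inv_into_f_f)
  show "map_prod ?h ?h ` parcs (relabel g G) \<subseteq> parcs G"
    using assms(2) pair_wf_digraph.wellformed'[OF assms(1)]
    by (auto simp: relabel_def the_inv_into_f_f)
qed


section \<open>Rankings of directed paths\<close>

lemma pair_wf_digraph_dpath: "pair_wf_digraph (dpath n)"
  by unfold_locales (auto simp: dpath_def)

lemma dpath_segment_reachable:
  assumes "1 \<le> a" "a \<le> b" "b \<le> n" "\<forall>x \<in> {a..b}. f x \<le> l"
  shows "(a, b) \<in> (low_arcs (dpath n) f l)\<^sup>*"
  using assms(2,3,4)
proof (induction b rule: dec_induct)
  case (step m)
  then have "(m, Suc m) \<in> low_arcs (dpath n) f l"
    using assms(1) by (auto simp: low_arcs_def dpath_def)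
  with step show ?case by (auto intro: rtrancl_into_rtrancl)
qed simp

text \<open>Induction on \<open>j\<close>: the top label \<open>Suc j\<close> occurs at most once,
  and removing it leaves two segments with labels up to \<open>j\<close>, so there are at most
  \<open>2 * (2 ^ j - 1) + 1\<close> vertices. The end \<open>b\<close> is exclusive, hence the
  bound \<open>Suc n\<close>.\<close>

lemma dpath_segment_length:
  assumes "k_ranking (dpath n) k f" "1 \<le> a" "b \<le> Suc n" "f ` {a..<b} \<subseteq> {1..j}"
  shows "b - a < 2 ^ j"
  using assms(2-4)
proof (induction j arbitrary: a b)
  case 0
  then show ?case by (cases "a < b") auto
next
  case (Suc j)
  interpret pair_wf_digraph "dpath n" by (rule pair_wf_digraph_dpath)
  \<comment> \<open>Between two occurrences of \<open>Suc j\<close> the path stays in the segment,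
    where no label exceeds \<open>Suc j\<close>.\<close>
  have unique: "x = y" if "x \<in> {a..<b}" "y \<in> {a..<b}" "f x = Suc j" "f y = Suc j" "x \<le> y" for x y
  proof -
    have "f z \<in> {1..Suc j}" if "z \<in> {x..y}" for z
    proof -
      have "z \<in> {a..<b}" using \<open>x \<in> {a..<b}\<close> \<open>y \<in> {a..<b}\<close> that by simp
      then show ?thesis using Suc.prems(3) by blast
    qed
    then have "\<forall>z \<in> {x..y}. f z \<le> Suc j" by simp
    then have "(x, y) \<in> (low_arcs (dpath n) f (Suc j))\<^sup>*"
      using dpath_segment_reachable[of x y n f "Suc j"] that Suc.prems by auto
    moreover have "x \<in> pverts (dpath n)" "y \<in> pverts (dpath n)"
      using that(1,2) Suc.prems(1,2) by (auto simp: dpath_def)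
    ultimately show ?thesis
      using assms(1) that(3,4) unfolding k_ranking_iff by metis
  qed
  show ?case
  proof (cases "\<exists>c \<in> {a..<b}. f c = Suc j")
    case True
    then obtain c where c: "c \<in> {a..<b}" "f c = Suc j" by blast
    have other: "f x \<in> {1..j}" if "x \<in> {a..<b}" "x \<noteq> c" for x
    proof -
      have "f x \<noteq> Suc j" using unique[of x c] unique[of c x] c that by (cases "x \<le> c") auto
      moreover have "f x \<in> {1..Suc j}" using Suc.prems(3) that by blast
      ultimately show ?thesis by auto
    qed
    have "f ` {a..<c} \<subseteq> {1..j}" "f ` {Suc c..<b} \<subseteq> {1..j}"
      using c(1) by (auto intro!: image_subsetI other simp del: atLeastAtMost_iff One_nat_def)
    then have "c - a < 2 ^ j" "b - Suc c < 2 ^ j"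
      using Suc.prems(1,2) c(1) by (auto intro!: Suc.IH)
    then show ?thesis using c(1) by auto
  next
    case False
    then have "f ` {a..<b} \<subseteq> {1..j}"
      using Suc.prems(3) by (force simp: le_Suc_eq)
    then have "b - a < 2 ^ j" using Suc by blast
    then show ?thesis by simp
  qed
qed

lemma k_ranking_dpath_lower_bound:
  assumes "k_ranking (dpath (2 ^ k - 1)) k' f"
  shows "k \<le> k'"
proof -
  have "f ` {1..<2 ^ k} \<subseteq> {1..k'}"
    using assms by (force simp: k_ranking_def dpath_def)
  then have "(2::nat) ^ k - 1 < 2 ^ k'"
    using dpath_segment_length[OF assms, of 1 "2 ^ k" k'] by simp
  then have "(2::nat) ^ k \<le> 2 ^ k'" by linarith
  then show ?thesis by simp
qed


section \<open>The standard ranking of the direct sum graphs\<close>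

text \<open>Positivity matters: \<open>multiplicity 2 0 = 0\<close> by convention, although every
  power of 2 divides 0.\<close>

lemma standard_label_le_iff:
  assumes "x > 0"
  shows "standard_label x \<le> l \<longleftrightarrow> \<not> 2 ^ l dvd x"
  using assms power_dvd_iff_le_multiplicity[of x 2 l] by (simp add: standard_label_def) linarith

text \<open>\<open>x\<close> is an odd multiple of \<open>2 ^ multiplicity 2 x\<close>. Hence
  vertices with equal label \<open>l\<close> agree modulo \<open>2 ^ l\<close>.\<close>

lemma standard_label_mod:
  assumes "x > 0"
  shows "x mod 2 ^ standard_label x = 2 ^ multiplicity 2 x"
proof -
  obtain m where m: "x = 2 ^ multiplicity 2 x * m" "\<not> 2 dvd m"
    using assms multiplicity_decompose'[of x 2] by auto
  then have "m mod 2 = 1" by presburger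
  have "x mod 2 ^ standard_label x = (2 ^ multiplicity 2 x * m) mod (2 ^ multiplicity 2 x * 2)"
    using m(1) by (simp add: standard_label_def mult.commute)
  also have "\<dots> = 2 ^ multiplicity 2 x" by (simp only: mult_mod_right [symmetric] \<open>m mod 2 = 1\<close> mult_1_right)
  finally show ?thesis .
qed

lemma standard_label_range:
  assumes "x \<in> {1..2 ^ k - 1}"
  shows "standard_label x \<in> {1..k}"
proof -
  have "\<not> 2 ^ k dvd x" using assms by (auto dest: dvd_imp_le)
  then show ?thesis using assms standard_label_le_iff[of x k] by (auto simp: standard_label_def)
qed

section \<open>Well-formedness and spanning directed paths of the direct sum graphs\<close>

lemma pair_wf_digraph_direct_sum_I: "i \<ge> 2 \<Longrightarrow> pair_wf_digraph (direct_sum_I i)"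
proof (induction i rule: nat_induct_at_least)
  case base
  show ?case by (simp add: direct_sum_I_2 pair_wf_digraph_dpath)
next
  case (Suc i)
  then interpret pair_wf_digraph "direct_sum_I i" by simp
  show ?case
    using Suc.hyps pverts_direct_sum_I[of i]
    by unfold_locales
      (auto simp: direct_sum_I_Suc extend_I_def relabel_def Let_def dest: wellformed')
qed

lemma pair_wf_digraph_direct_sum_II: "i \<ge> 2 \<Longrightarrow> pair_wf_digraph (direct_sum_II i)"
proof (induction i rule: nat_induct_at_least)
  case base
  show ?case by unfold_locales (auto simp: direct_sum_II_2 dpath_def)
next
  case (Suc i)
  then interpret pair_wf_digraph "direct_sum_II i" by simp
  \<comment> \<open>Ensures that the ends \<open>2 ^ i - 1\<close> and \<open>2 ^ i + 1\<close> of
    the two forward arcs at the centre are vertices.\<close>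
  have "(2::nat) ^ i \<ge> 2 ^ 2" using Suc.hyps by (intro power_increasing) auto
  then show ?case
    using Suc.hyps pverts_direct_sum_II[of i]
    by unfold_locales
      (auto simp: direct_sum_II_Suc extend_II_def relabel_def Let_def dest: wellformed')
qed

text \<open>By induction the path runs through the lower half, the centre \<open>2 ^ i\<close> and
  then the shifted half.\<close>

lemma dpath_le_direct_sum_I:
  assumes "i \<ge> 2"
  shows "parcs (dpath (2 ^ i - 1)) \<subseteq> parcs (direct_sum_I i)"
  using assms
proof (induction i rule: nat_induct_at_least)
  case base
  show ?case by (simp add: direct_sum_I_2)
next
  case (Suc i)
  have "(a, Suc a) \<in> parcs (direct_sum_I (Suc i))" if a: "1 \<le> a" "a < 2 ^ Suc i - 1" for a
  proof -
    \<comment> \<open>Inside the lower half, into the centre, out of the centre, inside the shifted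
      half.\<close>
    consider "a < 2 ^ i - 1" | "a = 2 ^ i - 1" | "a = 2 ^ i" | "2 ^ i < a" by linarith
    then show ?thesis
    proof cases
      case 1
      then have "(a, Suc a) \<in> parcs (direct_sum_I i)"
        using Suc.IH a by (auto simp: dpath_def)
      then show ?thesis using Suc.hyps by (simp add: direct_sum_I_Suc extend_I_def Let_def)
    next
      case 4
      define b where "b = a - 2 ^ i"
      have b: "a = 2 ^ i + b" "1 \<le> b" "b < 2 ^ i - 1" using 4 a by (auto simp: b_def)
      then have "(b, Suc b) \<in> parcs (direct_sum_I i)"
        using Suc.IH by (auto simp: dpath_def)
      then show ?thesis
        using Suc.hyps b(1) by (force simp: direct_sum_I_Suc extend_I_def relabel_def Let_def)
    qed (use a Suc.hyps in \<open>auto simp: direct_sum_I_Suc extend_I_def Let_def\<close>)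
  qed
  then show ?case by (auto simp: dpath_def)
qed

lemma dpath_le_direct_sum_II:
  assumes "i \<ge> 2"
  shows "parcs (dpath (2 ^ i - 1)) \<subseteq> parcs (direct_sum_II i)"
  using assms
proof (induction i rule: nat_induct_at_least)
  case base
  show ?case by (auto simp: direct_sum_II_2)
next
  case (Suc i)
  have "(a, Suc a) \<in> parcs (direct_sum_II (Suc i))" if a: "1 \<le> a" "a < 2 ^ Suc i - 1" for a
  proof -
    consider "a < 2 ^ i - 1" | "a = 2 ^ i - 1" | "a = 2 ^ i" | "2 ^ i < a" by linarith
    then show ?thesis
    proof cases
      case 1
      then have "(a, Suc a) \<in> parcs (direct_sum_II i)"
        using Suc.IH a by (auto simp: dpath_def)
      then show ?thesis using Suc.hyps by (simp add: direct_sum_II_Suc extend_II_def Let_def)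
    next
      case 4
      define b where "b = a - 2 ^ i"
      have b: "a = 2 ^ i + b" "1 \<le> b" "b < 2 ^ i - 1" using 4 a by (auto simp: b_def)
      then have "(b, Suc b) \<in> parcs (direct_sum_II i)"
        using Suc.IH by (auto simp: dpath_def)
      then show ?thesis
        using Suc.hyps b(1) by (force simp: direct_sum_II_Suc extend_II_def relabel_def Let_def)
    qed (use a Suc.hyps in \<open>auto simp: direct_sum_II_Suc extend_II_def Let_def\<close>)
  qed
  then show ?case by (auto simp: dpath_def)
qed

section \<open>Arcs of the direct sum graphs modulo powers of two\<close>

lemma direct_sum_I_less:
  assumes "i \<ge> 2" "(x, y) \<in> parcs (direct_sum_I i)"
  shows "x < y"
  using assms
proof (induction i arbitrary: x y rule: nat_induct_at_least)
  case base
  then show ?case by (auto simp: direct_sum_I_2 dpath_def)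
next
  case (Suc i)
  \<comment> \<open>For a cross arc \<open>(x, 2 ^ i + y)\<close>, \<open>wf\<close> and
    \<open>pos\<close> give \<open>x \<le> 2 ^ i < 2 ^ i + y\<close>.\<close>
  have wf: "x \<le> 2 ^ i" if "(x, y) \<in> parcs (direct_sum_I i)" for x y
    using pair_wf_digraph.wellformed'(1)[OF pair_wf_digraph_direct_sum_I that] Suc.hyps
      pverts_direct_sum_I[of i] by auto
  have pos: "y > 0" if "(x, y) \<in> parcs (direct_sum_I i)" for x y
    using Suc.IH that by fastforce
  show ?case
    using Suc.prems Suc.hyps Suc.IH
    by (auto simp: direct_sum_I_Suc extend_I_def relabel_def Let_def
        dest: wf pos intro: le_less_trans[OF wf] trans_less_add2)
qed

text \<open>Induction on \<open>i\<close>. For \<open>l \<le> i\<close> the centre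
  \<open>2 ^ i\<close> is a multiple of \<open>2 ^ l\<close>, so arcs at it are excluded; every
  other arc, cross arcs included, has the remainders of an arc of the smaller graph. For
  \<open>l > i\<close> all vertices lie below \<open>2 ^ l\<close> and are their own
  remainders.\<close>

lemma direct_sum_I_mod_less:
  assumes "i \<ge> 2" "(x, y) \<in> parcs (direct_sum_I i)" "\<not> 2 ^ l dvd x" "\<not> 2 ^ l dvd y"
  shows "x mod 2 ^ l < y mod 2 ^ l"
  using assms
proof (induction i arbitrary: x y rule: nat_induct_at_least)
  case base
  then have xy: "x = 1 \<and> y = 2 \<or> x = 2 \<and> y = 3" by (auto simp: direct_sum_I_2 dpath_def)
  \<comment> \<open>\<open>2 ^ 0\<close> divides everything, and both arcs have the even end 2; so
    \<open>l \<ge> 2\<close>, and 1, 2, 3 are their own remainders.\<close>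
  have "l \<noteq> 0" using base by (cases "l = 0") simp_all
  moreover have "l \<noteq> 1" using xy base by auto
  ultimately have "(2::nat) ^ 2 \<le> 2 ^ l" by (intro power_increasing) auto
  then show ?case using xy by auto
next
  case (Suc i)
  show ?case
  proof (cases "l \<le> i")
    case True
    then have dvd: "(2::nat) ^ l dvd 2 ^ i" by (rule le_imp_power_dvd)
    then have shift: "(2 ^ i + z) mod 2 ^ l = z mod 2 ^ l" "2 ^ l dvd 2 ^ i + z \<longleftrightarrow> 2 ^ l dvd z"
      for z :: nat
      by (metis add_0 mod_add_left_eq dvd_imp_mod_0) (simp add: dvd dvd_add_right_iff)
    show ?thesis
      using Suc.prems Suc.hyps Suc.IH dvd
      by (auto simp: direct_sum_I_Suc extend_I_def relabel_def Let_def shift)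
  next
    case False
    have "x < y" using direct_sum_I_less[of "Suc i"] Suc by auto
    moreover have "y < 2 ^ Suc i"
      using pair_wf_digraph.wellformed'(2)[OF pair_wf_digraph_direct_sum_I Suc.prems(1)] Suc.hyps
        pverts_direct_sum_I[of "Suc i"] by auto
    moreover have "(2::nat) ^ Suc i \<le> 2 ^ l" using False by (intro power_increasing) auto
    ultimately show ?thesis by simp
  qed
qed

text \<open>The new arcs of type II all touch the centre, so none joins the two halves directly. For
  \<open>l \<le> i\<close> the centre is excluded and both ends of a shifted arc gain the same
  \<open>2 ^ i div 2 ^ l\<close>; for \<open>l > i\<close> both quotients are 0.\<close>

lemma direct_sum_II_div_eq:
  assumes "i \<ge> 2" "(x, y) \<in> parcs (direct_sum_II i)" "\<not> 2 ^ l dvd x" "\<not> 2 ^ l dvd y"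
  shows "x div 2 ^ l = y div 2 ^ l"
  using assms
proof (induction i arbitrary: x y rule: nat_induct_at_least)
  case base
  then have xy: "x \<le> 3" "y \<le> 3" "x = 2 \<or> y = 2" by (auto simp: direct_sum_II_2 dpath_def)
  have "l \<noteq> 0" using base by (cases "l = 0") simp_all
  moreover have "l \<noteq> 1" using xy base by auto
  ultimately have "(2::nat) ^ 2 \<le> 2 ^ l" by (intro power_increasing) auto
  then show ?case using xy by auto
next
  case (Suc i)
  show ?case
  proof (cases "l \<le> i")
    case True
    then have dvd: "(2::nat) ^ l dvd 2 ^ i" by (rule le_imp_power_dvd)
    then have shift: "(2 ^ i + z) div 2 ^ l = 2 ^ i div 2 ^ l + z div 2 ^ l"
      "2 ^ l dvd 2 ^ i + z \<longleftrightarrow> 2 ^ l dvd z" for z :: nat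
      by (rule div_plus_div_distrib_dvd_left) (simp add: dvd dvd_add_right_iff)
    show ?thesis
      using Suc.prems Suc.hyps Suc.IH dvd
      by (auto simp: direct_sum_II_Suc extend_II_def relabel_def Let_def shift)
  next
    case False
    have "x < 2 ^ Suc i" "y < 2 ^ Suc i"
      using pair_wf_digraph.wellformed'[OF pair_wf_digraph_direct_sum_II Suc.prems(1)] Suc.hyps
        pverts_direct_sum_II[of "Suc i"] by auto
    moreover have "(2::nat) ^ Suc i \<le> 2 ^ l" using False by (intro power_increasing) auto
    ultimately show ?thesis by simp
  qed
qed

section \<open>Rankings obtained from the arc estimates\<close>

lemma k_ranking_direct_sum_I:
  assumes "k \<ge> 2"
  shows "k_ranking (direct_sum_I k) k standard_label"
proof -
  interpret pair_wf_digraph "direct_sum_I k" using assms by (rule pair_wf_digraph_direct_sum_I)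
  note V = pverts_direct_sum_I[OF assms]
  \<comment> \<open>A nonempty low walk strictly increases the remainder, whereas equal labels force
    equal remainders.\<close>
  have reach: "u = w \<or> u mod 2 ^ l < w mod 2 ^ l"
    if "(u, w) \<in> (low_arcs (direct_sum_I k) standard_label l)\<^sup>*" for u w l
    using that
  proof (induction rule: rtrancl_induct)
    case (step y z)
    then have "y > 0" "z > 0" using wellformed' V by (force simp: low_arcs_def)+
    then have "y mod 2 ^ l < z mod 2 ^ l"
      using step(2) direct_sum_I_mod_less[OF assms, of y z l]
      by (auto simp: low_arcs_def standard_label_le_iff)
    then show ?case using step.IH by auto
  qed simp
  show ?thesis
    unfolding k_ranking_iff
  proof (intro conjI ballI impI)
    show "standard_label \<in> pverts (direct_sum_I k) \<rightarrow> {1..k}"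
      using standard_label_range V by auto
    fix u w
    assume uw: "u \<in> pverts (direct_sum_I k)" "w \<in> pverts (direct_sum_I k)"
      and r: "standard_label u = standard_label w \<and>
        (u, w) \<in> (low_arcs (direct_sum_I k) standard_label (standard_label u))\<^sup>*"
    then have "u mod 2 ^ standard_label u = w mod 2 ^ standard_label u"
      using V standard_label_mod[of u] standard_label_mod[of w] by (auto simp: standard_label_def)
    then show "u = w" using reach r by force
  qed
qed

lemma k_ranking_direct_sum_II:
  assumes "k \<ge> 2"
  shows "k_ranking (direct_sum_II k) k standard_label"
proof -
  interpret pair_wf_digraph "direct_sum_II k" using assms by (rule pair_wf_digraph_direct_sum_II)
  note V = pverts_direct_sum_II[OF assms]
  \<comment> \<open>The constant quotient, with the remainder fixed by the label, determines the
    vertex.\<close>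
  have reach: "u div 2 ^ l = w div 2 ^ l"
    if "(u, w) \<in> (low_arcs (direct_sum_II k) standard_label l)\<^sup>*" for u w l
    using that
  proof (induction rule: rtrancl_induct)
    case (step y z)
    then have "y > 0" "z > 0" using wellformed' V by (force simp: low_arcs_def)+
    then have "y div 2 ^ l = z div 2 ^ l"
      using step(2) direct_sum_II_div_eq[OF assms, of y z l]
      by (auto simp: low_arcs_def standard_label_le_iff)
    then show ?case using step.IH by auto
  qed simp
  show ?thesis
    unfolding k_ranking_iff
  proof (intro conjI ballI impI)
    show "standard_label \<in> pverts (direct_sum_II k) \<rightarrow> {1..k}"
      using standard_label_range V by auto
    fix u w
    assume uw: "u \<in> pverts (direct_sum_II k)" "w \<in> pverts (direct_sum_II k)"
      and r: "standard_label u = standard_label w \<and>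
        (u, w) \<in> (low_arcs (direct_sum_II k) standard_label (standard_label u))\<^sup>*"
    then have "u mod 2 ^ standard_label u = w mod 2 ^ standard_label u"
      using V standard_label_mod[of u] standard_label_mod[of w] by (auto simp: standard_label_def)
    moreover have "u div 2 ^ standard_label u = w div 2 ^ standard_label u"
      using reach r by blast
    ultimately show "u = w" by (metis div_mult_mod_eq)
  qed
qed


section \<open>Gluing rankings at attachment vertices\<close>

text \<open>Gluing works for any ranked graph \<open>G\<close>. The cap \<open>h (a t)\<close> on
  the labels of \<open>N t\<close> also keeps them within \<open>k\<close>.\<close>

lemma k_ranking_pair_Union:
  fixes G :: "'a pair_pre_digraph" and N :: "'t \<Rightarrow> 'a pair_pre_digraph" and I :: "'t set"
  defines "\<Gamma> \<equiv> pair_Union (insert G (N ` I))"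
  assumes wf\<Gamma>: "pair_wf_digraph \<Gamma>" and wfG: "pair_wf_digraph G"
    and N: "\<And>t. t \<in> I \<Longrightarrow> pair_digraph (N t)"
    and meet: "\<And>t. t \<in> I \<Longrightarrow> pverts G \<inter> pverts (N t) = {a t}"
    and att: "\<And>t. t \<in> I \<Longrightarrow> attachment_verts (N t) \<Gamma> \<subseteq> {a t}"
    and rG: "k_ranking G k h"
    and rN: "\<And>t. t \<in> I \<Longrightarrow> k_ranking (N t) (h (a t)) (g t)"
    and ga: "\<And>t. t \<in> I \<Longrightarrow> g t (a t) = h (a t)"
  shows "\<exists>f. k_ranking \<Gamma> k f"
proof -
  interpret \<Gamma>: pair_wf_digraph \<Gamma> by fact
  interpret G: pair_wf_digraph G by fact
  have wfN: "pair_wf_digraph (N t)" if "t \<in> I" for t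
    using N[OF that] by (simp add: pair_digraph_def pair_fin_digraph_def)
  have V: "pverts \<Gamma> = pverts G \<union> (\<Union>t\<in>I. pverts (N t))"
    and A: "parcs \<Gamma> = parcs G \<union> (\<Union>t\<in>I. parcs (N t))"
    by (auto simp: \<Gamma>_def pair_Union_def)
  have aG: "a t \<in> pverts G" "a t \<in> pverts (N t)" if "t \<in> I" for t
    using meet[OF that] by auto
  \<comment> \<open>An arc of some \<open>N t\<close> with both ends in \<open>G\<close> would be a
    loop at \<open>a t\<close>.\<close>
  have arc_G: "(x, y) \<in> parcs G"
    if xy: "(x, y) \<in> parcs \<Gamma>" "x \<in> pverts G" "y \<in> pverts G" for x y
  proof (rule ccontr)
    assume "(x, y) \<notin> parcs G"
    then obtain t where t: "t \<in> I" "(x, y) \<in> parcs (N t)" using xy(1) A by auto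
    then have "x = a t" "y = a t"
      using meet[OF t(1)] pair_wf_digraph.wellformed'[OF wfN[OF t(1)] t(2)] xy by auto
    moreover have "x \<noteq> y"
      using N[OF t(1)] t(2) pair_loopfree_digraph.pair_no_loops[of "N t" "(x, y)"]
      by (auto simp: pair_digraph_def)
    ultimately show False by simp
  qed
  \<comment> \<open>Otherwise \<open>z\<close> would be a vertex of attachment of
    \<open>N t\<close>, hence \<open>a t\<close>, which lies in \<open>G\<close>.\<close>
  have arc_N: "(x, y) \<in> parcs (N t)"
    if "(x, y) \<in> parcs \<Gamma>" "t \<in> I" "z \<in> {x, y}" "z \<in> pverts (N t)" "z \<notin> pverts G" for x y z t
  proof (rule ccontr)
    assume "(x, y) \<notin> parcs (N t)"
    then have "z \<in> attachment_verts (N t) \<Gamma>"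
      using that by (force simp: attachment_verts_def)
    then show False using att[OF that(2)] aG(1)[OF that(2)] that(5) by auto
  qed
  \<comment> \<open>The \<open>N t\<close> may overlap outside \<open>G\<close>. The chosen index depends on \<open>x\<close> only through the set
    of all \<open>t\<close> with \<open>x\<close> in \<open>N t\<close>, so it is constant along arcs that avoid \<open>G\<close>.\<close>
  define \<tau> where "\<tau> x = (SOME t. t \<in> {t \<in> I. x \<in> pverts (N t)})" for x
  have \<tau>: "\<tau> x \<in> I" "x \<in> pverts (N (\<tau> x))" if "x \<in> pverts \<Gamma>" "x \<notin> pverts G" for x
  proof -
    have "\<exists>t. t \<in> {t \<in> I. x \<in> pverts (N t)}" using that V by auto
    from someI_ex[OF this] show "\<tau> x \<in> I" "x \<in> pverts (N (\<tau> x))" by (auto simp: \<tau>_def)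
  qed
  have \<tau>_eq: "\<tau> x = \<tau> y"
    if "(x, y) \<in> parcs \<Gamma>" "x \<notin> pverts G" "y \<notin> pverts G" for x y
  proof -
    \<comment> \<open>By \<open>arc_N\<close>, an \<open>N t\<close> containing either end contains
      the arc and so the other end.\<close>
    have "{t \<in> I. x \<in> pverts (N t)} = {t \<in> I. y \<in> pverts (N t)}"
      using arc_N[OF that(1), of _ x] arc_N[OF that(1), of _ y] that
        pair_wf_digraph.wellformed'[OF wfN] by blast
    then show ?thesis by (simp add: \<tau>_def)
  qed
  have cross: "x = a t"
    if "t \<in> I" "x \<in> pverts G" "(x, y) \<in> parcs (N t) \<or> (y, x) \<in> parcs (N t)" for x y t
    using that meet[of t] pair_wf_digraph.wellformed'[OF wfN[OF that(1)]] by blast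
  \<comment> \<open>By \<open>ga\<close> the two rankings agree at the attachment vertices.\<close>
  define f where "f x = (if x \<in> pverts G then h x else g (\<tau> x) x)" for x
  have fG: "f x = h x" if "x \<in> pverts G" for x using that by (simp add: f_def)
  have fN: "f x = g (\<tau> x) x" if "x \<notin> pverts G" for x using that by (simp add: f_def)
  have N_unique: "x = y" if "t \<in> I" "x \<in> pverts (N t)" "y \<in> pverts (N t)" "g t x = g t y"
      "(x, y) \<in> (low_arcs (N t) (g t) (g t x))\<^sup>*" for t x y
    using rN[OF that(1)] that(2-) unfolding pair_wf_digraph.k_ranking_iff[OF wfN[OF that(1)]]
    by blast
  have N_le: "g t x \<le> h (a t)" if "t \<in> I" "x \<in> pverts (N t)" for t x
    using rN[OF that(1)] that(2) by (auto simp: k_ranking_def)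

  have from_N:
    \<comment> \<open>Invariant: the walk is still outside \<open>G\<close> in its initial
      \<open>N (\<tau> x)\<close>, or it has already reached the exit \<open>a (\<tau> x)\<close>.
      The second alternative persists wherever the walk goes next.\<close>
    "z \<notin> pverts G \<and> \<tau> z = \<tau> x \<and> (x, z) \<in> (low_arcs (N (\<tau> x)) (g (\<tau> x)) l)\<^sup>* \<or>
     (x, a (\<tau> x)) \<in> (low_arcs (N (\<tau> x)) (g (\<tau> x)) l)\<^sup>* \<and> h (a (\<tau> x)) \<le> l"
    if "(x, z) \<in> (low_arcs \<Gamma> f l)\<^sup>*" "x \<in> pverts \<Gamma>" "x \<notin> pverts G" for x z l
    using that(1)
  proof (induction rule: rtrancl_induct)
    case base
    then show ?case using that by simp
  next
    case (step y z)
    let ?t = "\<tau> x"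
    have yz: "(y, z) \<in> parcs \<Gamma>" "f y \<le> l" "f z \<le> l" using step(2) by (auto simp: low_arcs_def)
    have t: "?t \<in> I" using \<tau> that by blast
    show ?case
      using step.IH
    proof (elim disjE conjE)
      assume y: "y \<notin> pverts G" "\<tau> y = ?t" "(x, y) \<in> (low_arcs (N ?t) (g ?t) l)\<^sup>*"
      have "y \<in> pverts (N ?t)" using \<tau>(2)[of y] y \<Gamma>.wellformed'(1)[OF yz(1)] by simp
      then have arc: "(y, z) \<in> parcs (N ?t)" using arc_N[OF yz(1) t, of y] y by simp
      show ?thesis
      proof (cases "z \<in> pverts G")
        case True
        then have z: "z = a ?t" using cross[OF t True] arc by blast
        then have "(y, z) \<in> low_arcs (N ?t) (g ?t) l" "h (a ?t) \<le> l"
          using arc yz y fG[OF True] fN ga[OF t] by (auto simp: low_arcs_def)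
        then show ?thesis using y(3) z by (auto intro: rtrancl_into_rtrancl)
      next
        case False
        then have "\<tau> z = ?t" using \<tau>_eq[OF yz(1)] y by simp
        moreover from this have "(y, z) \<in> low_arcs (N ?t) (g ?t) l"
          using arc yz y fN False by (auto simp: low_arcs_def)
        ultimately show ?thesis using y(3) False by (auto intro: rtrancl_into_rtrancl)
      qed
    qed blast
  qed

  \<comment> \<open>Excursions from \<open>G\<close> into an \<open>N t\<close> start and end at
    \<open>a t\<close>, so they can be cut out. Outside \<open>G\<close>, the invariant keeps the
    part in \<open>G\<close> up to \<open>a (\<tau> z)\<close> and the current excursion
    separately.\<close>
  have from_G:
    "if z \<in> pverts G then (x, z) \<in> (low_arcs G h l)\<^sup>*
     else (a (\<tau> z), z) \<in> (low_arcs (N (\<tau> z)) (g (\<tau> z)) l)\<^sup>* \<and> h (a (\<tau> z)) \<le> l \<and>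
       (x, a (\<tau> z)) \<in> (low_arcs G h l)\<^sup>*"
    if "(x, z) \<in> (low_arcs \<Gamma> f l)\<^sup>*" "x \<in> pverts G" for x z l
    using that(1)
  proof (induction rule: rtrancl_induct)
    case base
    then show ?case using that by simp
  next
    case (step y z)
    have yz: "(y, z) \<in> parcs \<Gamma>" "f y \<le> l" "f z \<le> l" using step(2) by (auto simp: low_arcs_def)
    note yzV = \<Gamma>.wellformed'[OF yz(1)]
    show ?case
    proof (cases "y \<in> pverts G"; cases "z \<in> pverts G")
      assume y: "y \<in> pverts G" and z: "z \<in> pverts G"
      then have "(y, z) \<in> low_arcs G h l"
        using arc_G[OF yz(1)] yz fG by (simp add: low_arcs_def)
      then show ?thesis using step.IH y z by (auto intro: rtrancl_into_rtrancl)
    next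
      assume y: "y \<in> pverts G" and z: "z \<notin> pverts G"
      have t: "\<tau> z \<in> I" using \<tau> yzV z by blast
      have arc: "(y, z) \<in> parcs (N (\<tau> z))"
        using arc_N[OF yz(1) t, of z] \<tau>(2)[of z] yzV z by simp
      then have "y = a (\<tau> z)" using cross[OF t y] by blast
      moreover from this have "(y, z) \<in> low_arcs (N (\<tau> z)) (g (\<tau> z)) l"
        using arc yz ga[OF t] fG[OF y] fN[OF z] by (simp add: low_arcs_def)
      ultimately show ?thesis using step.IH y z yz fG[OF y] by auto
    next
      assume y: "y \<notin> pverts G" and z: "z \<in> pverts G"
      have t: "\<tau> y \<in> I" using \<tau> yzV y by blast
      have "(y, z) \<in> parcs (N (\<tau> y))"
        using arc_N[OF yz(1) t, of y] \<tau>(2)[of y] yzV y by simp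
      then have "z = a (\<tau> y)" using cross[OF t z] by blast
      \<comment> \<open>The walk returns to the vertex where the excursion began, which the
        induction hypothesis already reaches inside \<open>G\<close>.\<close>
      then show ?thesis using step.IH y z by auto
    next
      assume y: "y \<notin> pverts G" and z: "z \<notin> pverts G"
      have t: "\<tau> y \<in> I" using \<tau> yzV y by blast
      have "(y, z) \<in> parcs (N (\<tau> y))"
        using arc_N[OF yz(1) t, of y] \<tau>(2)[of y] yzV y by simp
      then have "(y, z) \<in> low_arcs (N (\<tau> z)) (g (\<tau> z)) l"
        using yz \<tau>_eq[OF yz(1) y z] fN[OF y] fN[OF z] by (simp add: low_arcs_def)
      then show ?thesis
        using step.IH y z \<tau>_eq[OF yz(1) y z] by (auto intro: rtrancl_into_rtrancl)
    qed
  qed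

  have "k_ranking \<Gamma> k f"
    unfolding \<Gamma>.k_ranking_iff
  proof (intro conjI ballI impI)
    have "f x \<in> {1..k}" if x: "x \<in> pverts \<Gamma>" for x
    proof (cases "x \<in> pverts G")
      case True
      then show ?thesis using rG fG by (auto simp: k_ranking_def)
    next
      case False
      then have "g (\<tau> x) x \<in> {1..h (a (\<tau> x))}" "h (a (\<tau> x)) \<le> k"
        using rN[of "\<tau> x"] \<tau>[OF x] rG aG(1)[of "\<tau> x"] by (auto simp: k_ranking_def Pi_iff)
      then show ?thesis using False fN by auto
    qed
    then show "f \<in> pverts \<Gamma> \<rightarrow> {1..k}" by blast
  next
    fix u w
    assume uw: "u \<in> pverts \<Gamma>" "w \<in> pverts \<Gamma>"
      and r: "f u = f w \<and> (u, w) \<in> (low_arcs \<Gamma> f (f u))\<^sup>*"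
    show "u = w"
    proof (cases "u \<in> pverts G")
      case False
      let ?t = "\<tau> u"
      note t = \<tau>[OF uw(1) False]
      \<comment> \<open>Exiting requires \<open>h (a ?t) \<le> f u\<close>, and \<open>N_le\<close>
        gives the converse. Then \<open>u\<close> and \<open>a ?t\<close> share a label with nothing
        higher between, so \<open>u = a ?t\<close> would lie in \<open>G\<close>.\<close>
      have "\<not> ((u, a ?t) \<in> (low_arcs (N ?t) (g ?t) (f u))\<^sup>* \<and> h (a ?t) \<le> f u)"
      proof
        assume *: "(u, a ?t) \<in> (low_arcs (N ?t) (g ?t) (f u))\<^sup>* \<and> h (a ?t) \<le> f u"
        then have "g ?t u = g ?t (a ?t)"
          using N_le[OF t] ga[OF t(1)] fN[OF False] by simp
        moreover have "(u, a ?t) \<in> (low_arcs (N ?t) (g ?t) (g ?t u))\<^sup>*"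
          using * fN[OF False] by simp
        ultimately have "u = a ?t" by (rule N_unique[OF t aG(2)[OF t(1)]])
        then show False using False aG[OF t(1)] by simp
      qed
      then have w: "w \<notin> pverts G" "\<tau> w = ?t" "(u, w) \<in> (low_arcs (N ?t) (g ?t) (f u))\<^sup>*"
        using from_N[of u w "f u"] r uw False by blast+
      have "w \<in> pverts (N ?t)" using \<tau>(2)[OF uw(2) w(1)] w(2) by simp
      moreover have "g ?t u = g ?t w" using r fN[OF False] fN[OF w(1)] w(2) by simp
      moreover have "(u, w) \<in> (low_arcs (N ?t) (g ?t) (g ?t u))\<^sup>*"
        using w(3) fN[OF False] by simp
      ultimately show ?thesis by (rule N_unique[OF t])
    next
      case True
      show ?thesis
      proof (cases "w \<in> pverts G")
        case w: True
        then have "(u, w) \<in> (low_arcs G h (h u))\<^sup>*"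
          using from_G[of u w "f u"] conjunct2[OF r] True fG[OF True] by simp
        then show ?thesis
          using rG True w r fG unfolding G.k_ranking_iff by metis
      next
        case w: False
        let ?t = "\<tau> w"
        note t = \<tau>[OF uw(2) w]
        \<comment> \<open>Mirror image: entering at \<open>a ?t\<close> forces \<open>w\<close> to
          carry the label of \<open>a ?t\<close>, so \<open>w = a ?t\<close> would lie in
          \<open>G\<close>.\<close>
        have reach: "(a ?t, w) \<in> (low_arcs (N ?t) (g ?t) (f w))\<^sup>*" "h (a ?t) \<le> f w"
          using from_G[of u w "f u"] r True w by auto
        then have "g ?t (a ?t) = g ?t w" using N_le[OF t] ga[OF t(1)] fN[OF w] by simp
        moreover from this have "(a ?t, w) \<in> (low_arcs (N ?t) (g ?t) (g ?t (a ?t)))\<^sup>*"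
          using reach(1) fN[OF w] by simp
        ultimately have "a ?t = w" by (rule N_unique[OF t(1) aG(2)[OF t(1)] t(2)])
        then show ?thesis using w aG[OF t(1)] by simp
      qed
    qed
  qed
  then show ?thesis by blast
qed

section \<open>The rank number of the union\<close>

theorem theorem9:
  fixes k :: nat
    and v :: "nat \<Rightarrow> 'a"
    and G' \<Gamma>' :: "'a pair_pre_digraph"
    and I :: "'t set"
    and N :: "'t \<Rightarrow> 'a pair_pre_digraph"
    and i :: "'t \<Rightarrow> nat"
  assumes "k \<ge> 2"
    and "inj_on v {1..2 ^ k - 1}"
    and "G' = relabel v (direct_sum_I k) \<or> G' = relabel v (direct_sum_II k)"
    and "\<And>t. t \<in> I \<Longrightarrow> pair_digraph (N t)"
    and "\<Gamma>' = pair_Union (insert G' (N ` I))"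
    and "pair_digraph \<Gamma>'"
    and "\<And>t. t \<in> I \<Longrightarrow> i t \<in> {2..2 ^ k - 2}"
    and "\<And>t. t \<in> I \<Longrightarrow> pverts G' \<inter> pverts (N t) = {v (i t)}"
    and "\<And>t. t \<in> I \<Longrightarrow> attachment_verts (N t) \<Gamma>' = {v (i t)}"
    and "\<And>t. t \<in> I \<Longrightarrow> rank_number (N t) = standard_label (i t)"
    and "\<And>t. t \<in> I \<Longrightarrow> \<exists>f. k_ranking (N t) (rank_number (N t)) f \<and> f (v (i t)) = standard_label (i t)"
  shows "rank_number \<Gamma>' = rank_number (dpath (2 ^ k - 1))"
proof -
  \<comment> \<open>\<open>D\<close> stands for either type, which enters the argument only through
    these facts.\<close>
  obtain D where D: "G' = relabel v D" "pair_wf_digraph D" "pverts D = {1..2 ^ k - 1}"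
      "parcs (dpath (2 ^ k - 1)) \<subseteq> parcs D" "k_ranking D k standard_label"
    using assms(1,3) pair_wf_digraph_direct_sum_I pair_wf_digraph_direct_sum_II
      pverts_direct_sum_I pverts_direct_sum_II dpath_le_direct_sum_I dpath_le_direct_sum_II
      k_ranking_direct_sum_I k_ranking_direct_sum_II by metis
  let ?P = "dpath (2 ^ k - 1)"
  let ?h = "standard_label \<circ> the_inv_into (pverts D) v"
  have wf\<Gamma>: "pair_wf_digraph \<Gamma>'"
    using assms(6) by (simp add: pair_digraph_def pair_fin_digraph_def)
  have inj: "inj_on v (pverts D)" using assms(2) D(3) by simp
  have hv: "?h (v (i t)) = standard_label (i t)" if "t \<in> I" for t
  proof -
    have "i t \<in> pverts D" using assms(7)[OF that] D(3) by auto
    then show ?thesis by (simp add: the_inv_into_f_f[OF inj])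
  qed
  obtain g where g: "\<And>t. t \<in> I \<Longrightarrow> k_ranking (N t) (rank_number (N t)) (g t)"
      "\<And>t. t \<in> I \<Longrightarrow> g t (v (i t)) = standard_label (i t)"
    using assms(11) by metis
  have "\<exists>f. k_ranking (pair_Union (insert G' (N ` I))) k f"
  proof (rule k_ranking_pair_Union[where a = "\<lambda>t. v (i t)" and h = ?h and g = g])
    show "k_ranking G' k ?h" unfolding D(1) by (rule k_ranking_relabel[OF D(2) inj D(5)])
    show "pair_wf_digraph G'" unfolding D(1) by (rule pair_wf_digraph_relabel[OF D(2)])
  qed (use assms(4-10) wf\<Gamma> g hv in simp_all)
  then obtain f where f: "k_ranking \<Gamma>' k f" using assms(5) by blast
  \<comment> \<open>\<open>v\<close> embeds the path in \<open>\<Gamma>'\<close>. Pulling rankings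
    back gives the lower bound for \<open>\<Gamma>'\<close> and, applied to \<open>f\<close>, a
    \<open>k\<close>-ranking of the path.\<close>
  have path: "k_ranking ?P k' (f' \<circ> v)" if "k_ranking \<Gamma>' k' f'" for k' f'
  proof (rule k_ranking_pullback[OF wf\<Gamma> pair_wf_digraph_dpath that])
    show "inj_on v (pverts ?P)" using assms(2) by (simp add: dpath_def)
    show "v ` pverts ?P \<subseteq> pverts \<Gamma>'"
      using D(3) unfolding assms(5) D(1) by (auto simp: pair_Union_def relabel_def dpath_def)
    show "map_prod v v ` parcs ?P \<subseteq> parcs \<Gamma>'"
      using D(4) unfolding assms(5) D(1) by (auto simp: pair_Union_def relabel_def)
  qed
  have "rank_number \<Gamma>' = k"
    using f k_ranking_dpath_lower_bound path by (blast intro: rank_number_eqI)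
  moreover have "rank_number ?P = k"
    using path[OF f] k_ranking_dpath_lower_bound by (blast intro: rank_number_eqI)
  ultimately show ?thesis by simp
qed

end
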